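(* Let $H$ be any graph, let $u$ and $v$ be distinct vertices of $H$, and let $n$ be a natural number. If $H$ contains $n$ edge-disjoint $u$–$v$ paths, then $H$ also contains $n$ edge-disjoint pairwise order-compatible $u$–$v$ paths.
   Context: Two $u$–$v$ paths are order-compatible if they traverse their common vertices in the same order. *)

theory Defs
  imports Main
begin

text \<open>
  Graphs are undirected and simple, given by a vertex set \<open>V\<close> and a set \<open>E\<close> of two-element
  subsets of \<open>V\<close>. Neither set is required to be finite.
\<close>

definition simple_graph :: "'a set \<Rightarrow> 'a set set \<Rightarrow> bool" where
  "simple_graph V E \<longleftrightarrow> (\<forall>e\<in>E. e \<subseteq> V \<and> card e = 2)"

text \<open>
  A path is represented by the list of its vertices. For \<open>u \<noteq> v\<close> a \<open>u\<close>--\<open>v\<close> path, viewed as a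
  subgraph, corresponds to exactly one such list from \<open>u\<close> to \<open>v\<close>.
\<close>

definition path_edges :: "'a list \<Rightarrow> 'a set set" where
  "path_edges p = {{p ! i, p ! Suc i} | i. Suc i < length p}"

definition is_path :: "'a set \<Rightarrow> 'a set set \<Rightarrow> 'a \<Rightarrow> 'a \<Rightarrow> 'a list \<Rightarrow> bool" where
  "is_path V E u v p \<longleftrightarrow>
     p \<noteq> [] \<and> hd p = u \<and> last p = v \<and> distinct p \<and> set p \<subseteq> V \<and> path_edges p \<subseteq> E"

definition edge_disjoint :: "'a list \<Rightarrow> 'a list \<Rightarrow> bool" where
  "edge_disjoint p q \<longleftrightarrow> path_edges p \<inter> path_edges q = {}"

definition precedes_on :: "'a list \<Rightarrow> 'a \<Rightarrow> 'a \<Rightarrow> bool" where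
  "precedes_on p x y \<longleftrightarrow> (\<exists>i j. i < j \<and> j < length p \<and> p ! i = x \<and> p ! j = y)"

definition order_compatible :: "'a list \<Rightarrow> 'a list \<Rightarrow> bool" where
  "order_compatible p q \<longleftrightarrow>
     (\<forall>x \<in> set p \<inter> set q. \<forall>y \<in> set p \<inter> set q. precedes_on p x y \<longleftrightarrow> precedes_on q x y)"

end

theory Submission
  imports Defs
begin

text \<open>
  Among all families of \<open>n\<close> edge-disjoint \<open>u\<close>--\<open>v\<close> paths, one of minimal total length is pairwise
  order-compatible: if \<open>p\<close> visits \<open>x\<close> before \<open>y\<close> but \<open>q\<close> visits \<open>y\<close> before \<open>x\<close>, then following
  \<open>p\<close> up to \<open>x\<close> and \<open>q\<close> from there on, and \<open>q\<close> up to \<open>y\<close> and \<open>p\<close> from there on, gives two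
  edge-disjoint walks that avoid the segments between \<open>x\<close> and \<open>y\<close>; paths inside these walks make
  the family shorter.
\<close>

lemma path_edges_Nil [simp]: "path_edges [] = {}"
  by (simp add: path_edges_def)

lemma path_edges_single [simp]: "path_edges [x] = {}"
  by (simp add: path_edges_def)

lemma path_edges_Cons_Cons [simp]:
  "path_edges (x # y # zs) = insert {x, y} (path_edges (y # zs))"
proof -
  \<comment> \<open>Written as an image, the edge set splits along its indices: index 0 gives the
    first edge, and the successors give the edges of the tail.\<close>
  have "path_edges (x # y # zs) =
      (\<lambda>i. {(x # y # zs) ! i, (x # y # zs) ! Suc i}) ` {i. Suc i < length (x # y # zs)}"
    unfolding path_edges_def by blast
  also have "{i. Suc i < length (x # y # zs)} = insert 0 (Suc ` {i. Suc i < length (y # zs)})"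
    by (auto simp: image_iff less_Suc_eq_0_disj gr0_conv_Suc)
  also have "(\<lambda>i. {(x # y # zs) ! i, (x # y # zs) ! Suc i}) ` \<dots> =
      insert {x, y} ((\<lambda>i. {(y # zs) ! i, (y # zs) ! Suc i}) ` {i. Suc i < length (y # zs)})"
    by (simp add: image_image)
  also have "\<dots> = insert {x, y} (path_edges (y # zs))"
    unfolding path_edges_def by blast
  finally show ?thesis .
qed

lemma path_edges_append:
  "path_edges (xs @ y # ys) = path_edges (xs @ [y]) \<union> path_edges (y # ys)"
proof (induction xs)
  case (Cons a xs)
  then show ?case by (cases xs) auto
qed simp

lemma path_edges_subset_set: "e \<in> path_edges p \<Longrightarrow> e \<noteq> {} \<and> e \<subseteq> set p"
  by (auto simp: path_edges_def)

lemma path_edges_disjoint_if_set_disjoint: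
  assumes "set p \<inter> set q = {}"
  shows "path_edges p \<inter> path_edges q = {}"
  using assms path_edges_subset_set[of _ p] path_edges_subset_set[of _ q] by blast

text \<open>Edge-disjointness tells two paths apart only if they have edges; this is where
  \<open>u \<noteq> v\<close> enters.\<close>

lemma path_edges_nonempty:
  assumes "is_path V E u v p" "u \<noteq> v"
  shows "path_edges p \<noteq> {}"
proof -
  obtain a b zs where "p = a # b # zs"
    using assms unfolding is_path_def
    by (metis last_ConsL list.exhaust list.sel(1))
  then show ?thesis by simp
qed

text \<open>Cutting out the closed walk between two occurrences of a vertex shortens the walk, keeps
  its ends and adds no edge. Repeating this ends in a path.\<close>

lemma walk_contains_path:
  assumes "w \<noteq> []" "hd w = u" "last w = v" "set w \<subseteq> V" "path_edges w \<subseteq> E"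
  shows "\<exists>p. is_path V E u v p \<and> path_edges p \<subseteq> path_edges w \<and> length p \<le> length w"
  using assms
proof (induction w rule: length_induct)
  case (1 w)
  show ?case
  proof (cases "distinct w")
    case True
    with 1 show ?thesis by (auto simp: is_path_def)
  next
    case False
    then obtain xs ys zs y where w: "w = xs @ y # ys @ y # zs"
      using not_distinct_decomp[OF False] by auto
    let ?w = "xs @ y # zs"
    have sub: "path_edges ?w \<subseteq> path_edges w"
      using path_edges_append[of xs y zs] path_edges_append[of xs y "ys @ y # zs"]
        path_edges_append[of "y # ys" y zs]
      by (auto simp: w)
    have "length ?w < length w" "?w \<noteq> []" "hd ?w = u" "last ?w = v" "set ?w \<subseteq> V"
      using 1(3,4,5) by (auto simp: w hd_append)
    with 1 sub obtain p where
      "is_path V E u v p" "path_edges p \<subseteq> path_edges ?w" "length p \<le> length ?w"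
      by (meson subset_trans)
    with sub \<open>length ?w < length w\<close> show ?thesis
      by (meson less_imp_le order_trans subset_trans)
  qed
qed

lemma precedes_on_imp_split:
  assumes "precedes_on p x y"
  obtains a b c where "p = a @ x # b @ y # c"
proof -
  obtain i j where ij: "i < j" "j < length p" "p ! i = x" "p ! j = y"
    using assms by (auto simp: precedes_on_def)
  then have "p = take i p @ x # drop (Suc i) p"
    using id_take_nth_drop[of i p] by simp
  moreover have "y \<in> set (drop (Suc i) p)"
    using ij by (auto simp: in_set_conv_nth intro!: exI[of _ "j - Suc i"])
  ultimately show ?thesis
    using that by (metis split_list)
qed

lemma precedes_on_total:
  assumes "x \<in> set p" "y \<in> set p" "x \<noteq> y"
  shows "precedes_on p x y \<or> precedes_on p y x"
  using assms unfolding precedes_on_def in_set_conv_nth by (metis linorder_neqE_nat)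

lemma precedes_on_irrefl: "distinct p \<Longrightarrow> \<not> precedes_on p x x"
  by (auto simp: precedes_on_def nth_eq_iff_index_eq)

text \<open>If the two lists disagree on a pair, one has it in order and the other does not. The
  pair consists of distinct vertices by irreflexivity, so by totality the other list has it
  reversed; renaming the vertices covers both directions.\<close>

lemma not_order_compatibleE:
  assumes "\<not> order_compatible p q" "distinct p" "distinct q"
  obtains x y where "precedes_on p x y" "precedes_on q y x"
  using assms precedes_on_total precedes_on_irrefl
  unfolding order_compatible_def by (metis IntD1 IntD2)

lemma uncross_paths:
  assumes p: "is_path V E u v p" and q: "is_path V E u v q"
    and disj: "edge_disjoint p q" and incomp: "\<not> order_compatible p q"
  obtains p' q' where "is_path V E u v p'" "is_path V E u v q'" "edge_disjoint p' q'"
    "path_edges p' \<union> path_edges q' \<subseteq> path_edges p \<union> path_edges q"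
    "length p' + length q' < length p + length q"
proof -
  obtain x y where "precedes_on p x y" "precedes_on q y x"
    using incomp p q by (auto simp: is_path_def elim: not_order_compatibleE)
  then obtain a b c d e f where ps: "p = a @ x # b @ y # c" and qs: "q = d @ y # e @ x # f"
    by (metis precedes_on_imp_split)
  let ?w = "a @ x # f" and ?z = "d @ y # c"
  have pe: "path_edges p = path_edges (a @ [x]) \<union> path_edges (x # b @ [y]) \<union> path_edges (y # c)"
    using path_edges_append[of a x "b @ y # c"] path_edges_append[of "x # b" y c]
    by (auto simp: ps)
  have qe: "path_edges q = path_edges (d @ [y]) \<union> path_edges (y # e @ [x]) \<union> path_edges (x # f)"
    using path_edges_append[of d y "e @ x # f"] path_edges_append[of "y # e" x f]
    by (auto simp: qs)
  have we: "path_edges ?w = path_edges (a @ [x]) \<union> path_edges (x # f)"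
    and ze: "path_edges ?z = path_edges (d @ [y]) \<union> path_edges (y # c)"
    by (rule path_edges_append)+
  \<comment> \<open>Each new walk takes one piece from each old path. Pieces from different paths
    share no edge by \<open>disj\<close>; two pieces of the same path do not even share a vertex,
    because the segment between \<open>x\<close> and \<open>y\<close> separates them.\<close>
  have "path_edges (a @ [x]) \<inter> path_edges (y # c) = {}"
    by (rule path_edges_disjoint_if_set_disjoint) (use p in \<open>auto simp: is_path_def ps\<close>)
  moreover have "path_edges (d @ [y]) \<inter> path_edges (x # f) = {}"
    by (rule path_edges_disjoint_if_set_disjoint) (use q in \<open>auto simp: is_path_def qs\<close>)
  ultimately have wz: "path_edges ?w \<inter> path_edges ?z = {}"
    using disj unfolding edge_disjoint_def pe qe we ze by blast
  have sub: "path_edges ?w \<union> path_edges ?z \<subseteq> path_edges p \<union> path_edges q"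
    unfolding pe qe we ze by blast
  have E: "path_edges p \<union> path_edges q \<subseteq> E"
    using p q by (auto simp: is_path_def)
  \<comment> \<open>\<open>a\<close> and \<open>f\<close> come from different paths and may meet, so
    \<open>?w\<close> is in general only a walk.\<close>
  have "\<exists>p'. is_path V E u v p' \<and> path_edges p' \<subseteq> path_edges ?w \<and> length p' \<le> length ?w"
    by (rule walk_contains_path)
      (use p q sub E in \<open>auto simp: is_path_def ps qs hd_append\<close>)
  then obtain p' where p': "is_path V E u v p'" "path_edges p' \<subseteq> path_edges ?w"
    "length p' \<le> length ?w"
    by blast
  have "\<exists>q'. is_path V E u v q' \<and> path_edges q' \<subseteq> path_edges ?z \<and> length q' \<le> length ?z"
    by (rule walk_contains_path)
      (use p q sub E in \<open>auto simp: is_path_def ps qs hd_append\<close>)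
  then obtain q' where q': "is_path V E u v q'" "path_edges q' \<subseteq> path_edges ?z"
    "length q' \<le> length ?z"
    by blast
  show ?thesis
  proof (rule that[OF p'(1) q'(1)])
    show "edge_disjoint p' q'"
      using p'(2) q'(2) wz unfolding edge_disjoint_def by blast
    show "path_edges p' \<union> path_edges q' \<subseteq> path_edges p \<union> path_edges q"
      using p'(2) q'(2) sub by blast
    \<comment> \<open>The inequality is strict even if \<open>b\<close> and \<open>e\<close> are
      empty: \<open>p\<close> and \<open>q\<close> both list \<open>x\<close> and \<open>y\<close>
      at the crossing, while \<open>?w\<close> keeps only that \<open>x\<close> and
      \<open>?z\<close> only that \<open>y\<close>.\<close>
    show "length p' + length q' < length p + length q"
      using p'(3) q'(3) by (simp add: ps qs)
  qed
qed

definition disjoint_path_family ::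
    "'a set \<Rightarrow> 'a set set \<Rightarrow> 'a \<Rightarrow> 'a \<Rightarrow> nat \<Rightarrow> 'a list set \<Rightarrow> bool" where
  "disjoint_path_family V E u v n P \<longleftrightarrow>
     finite P \<and> card P = n \<and> (\<forall>p\<in>P. is_path V E u v p) \<and> pairwise edge_disjoint P"

lemma shorter_family_if_not_order_compatible:
  assumes P: "disjoint_path_family V E u v n P" and "u \<noteq> v"
    and pq: "p \<in> P" "q \<in> P" "p \<noteq> q" "\<not> order_compatible p q"
  shows "\<exists>Q. disjoint_path_family V E u v n Q \<and> sum length Q < sum length P"
proof -
  let ?R = "P - {p, q}"
  have fin: "finite P" and card: "card P = n" and paths: "\<And>r. r \<in> P \<Longrightarrow> is_path V E u v r"
    and disj: "\<And>r s. r \<in> P \<Longrightarrow> s \<in> P \<Longrightarrow> r \<noteq> s \<Longrightarrow> path_edges r \<inter> path_edges s = {}"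
    using P by (auto simp: disjoint_path_family_def pairwise_def edge_disjoint_def)
  obtain p' q' where new: "is_path V E u v p'" "is_path V E u v q'" "edge_disjoint p' q'"
    and sub: "path_edges p' \<union> path_edges q' \<subseteq> path_edges p \<union> path_edges q"
    and len: "length p' + length q' < length p + length q"
    using uncross_paths[OF paths paths _ pq(4)] disj pq by (metis edge_disjoint_def)
  have R: "path_edges p' \<inter> path_edges r = {} \<and> path_edges q' \<inter> path_edges r = {}"
    if "r \<in> ?R" for r
    using disj[of p r] disj[of q r] pq sub that by blast
  have nonempty: "path_edges p' \<noteq> {}" "path_edges q' \<noteq> {}"
    using new path_edges_nonempty \<open>u \<noteq> v\<close> by metis+
  \<comment> \<open>The family is a set, so a coincidence would lower its cardinality. Coinciding
    paths would have an edge set disjoint from itself, contradicting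
    \<open>nonempty\<close>.\<close>
  have notin: "p' \<noteq> q'" "p' \<notin> ?R" "q' \<notin> ?R"
    using R new(3) nonempty by (auto simp: edge_disjoint_def)
  have P_eq: "P = insert p (insert q ?R)"
    using pq by blast
  let ?Q = "insert p' (insert q' ?R)"
  have "card P = Suc (Suc (card ?R))" "sum length P = length p + (length q + sum length ?R)"
    using fin pq(3) by (subst P_eq; simp)+
  moreover have "card ?Q = Suc (Suc (card ?R))"
    "sum length ?Q = length p' + (length q' + sum length ?R)"
    using fin notin by simp_all
  moreover have "pairwise edge_disjoint ?Q"
    using R new(3) disj by (auto simp: pairwise_def edge_disjoint_def Int_commute)
  ultimately have "disjoint_path_family V E u v n ?Q" "sum length ?Q < sum length P"
    using fin card paths new len by (auto simp: disjoint_path_family_def)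
  then show ?thesis by blast
qed

theorem theorem2p1:
  fixes V :: "'a set" and E :: "'a set set" and u v :: 'a and n :: nat
  assumes "simple_graph V E"
    and "u \<in> V" and "v \<in> V" and "u \<noteq> v"
    and "\<exists>P. finite P \<and> card P = n \<and> (\<forall>p\<in>P. is_path V E u v p) \<and> pairwise edge_disjoint P"
  shows "\<exists>Q. finite Q \<and> card Q = n \<and> (\<forall>q\<in>Q. is_path V E u v q) \<and> pairwise edge_disjoint Q
           \<and> pairwise order_compatible Q"
proof -
  obtain P where "disjoint_path_family V E u v n P"
    using assms(5) unfolding disjoint_path_family_def by blast
  \<comment> \<open>Total length is a natural number, so a minimum is attained even if the graph is
    infinite.\<close>
  then obtain Q where Q: "disjoint_path_family V E u v n Q"
    and min: "\<And>R. disjoint_path_family V E u v n R \<Longrightarrow> sum length Q \<le> sum length R"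
    using ex_has_least_nat[of "disjoint_path_family V E u v n" P "sum length"] by blast
  have "pairwise order_compatible Q"
    using shorter_family_if_not_order_compatible[OF Q \<open>u \<noteq> v\<close>] min
    unfolding pairwise_def by (meson not_le)
  with Q show ?thesis
    unfolding disjoint_path_family_def by blast
qed

end
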